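(* The category $\mathbf{IA_{0,1}}$ of bounded implication algebras and bounded implication algebra homomorphisms is isomorphic to the category $\mathbf{BA}$ of Boolean algebras and Boolean algebra homomorphisms.
   Context: An implication algebra is a set $A$ with a binary operation $\cdot$ satisfying, for all $x,y,z\in A$: (1) $(x\cdot y)\cdot x=x$; (2) $(x\cdot y)\cdot y=(y\cdot x)\cdot x$; (3) $x\cdot(y\cdot z)=y\cdot(x\cdot z)$. In any implication algebra the element $x\cdot x$ does not depend on $x$; it is denoted $c_1$. A bounded implication algebra is an implication algebra equipped with a constant $c_0\in A$ satisfying $c_0\cdot x=c_1$ for all $x\in A$. A homomorphism $h\colon A\to B$ of bounded implication algebras is a function with $h(x\cdot y)=h(x)\cdot h(y)$ for all $x,y$ and $h(c_0)=c_0$. Two categories are isomorphic if there are functors between them, in opposite directions, whose composites are the respective identity functors. *)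

theory Defs
  imports "HOL-Algebra.Congruence" "HOL-Library.FuncSet"
begin

section \<open>Categories, functors, isomorphism of categories\<close>

record ('o, 'm) category =
  Obj   :: "'o set"
  Arr   :: "'m set"
  Dom   :: "'m \<Rightarrow> 'o"
  Cod   :: "'m \<Rightarrow> 'o"
  Ident :: "'o \<Rightarrow> 'm"
  Comp  :: "'m \<Rightarrow> 'm \<Rightarrow> 'm"  (* Comp C g f is g after f *)

locale category =
  fixes C :: "('o, 'm, 'z) category_scheme"
  assumes dom_obj: "f \<in> Arr C \<Longrightarrow> Dom C f \<in> Obj C"
    and cod_obj: "f \<in> Arr C \<Longrightarrow> Cod C f \<in> Obj C"
    and ident_arr: "X \<in> Obj C \<Longrightarrow> Ident C X \<in> Arr C"
    and dom_ident: "X \<in> Obj C \<Longrightarrow> Dom C (Ident C X) = X"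
    and cod_ident: "X \<in> Obj C \<Longrightarrow> Cod C (Ident C X) = X"
    and comp_arr: "\<lbrakk>f \<in> Arr C; g \<in> Arr C; Cod C f = Dom C g\<rbrakk> \<Longrightarrow> Comp C g f \<in> Arr C"
    and dom_comp: "\<lbrakk>f \<in> Arr C; g \<in> Arr C; Cod C f = Dom C g\<rbrakk> \<Longrightarrow> Dom C (Comp C g f) = Dom C f"
    and cod_comp: "\<lbrakk>f \<in> Arr C; g \<in> Arr C; Cod C f = Dom C g\<rbrakk> \<Longrightarrow> Cod C (Comp C g f) = Cod C g"
    and comp_ident_right: "f \<in> Arr C \<Longrightarrow> Comp C f (Ident C (Dom C f)) = f"
    and comp_ident_left: "f \<in> Arr C \<Longrightarrow> Comp C (Ident C (Cod C f)) f = f"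
    and comp_assoc: "\<lbrakk>f \<in> Arr C; g \<in> Arr C; h \<in> Arr C; Cod C f = Dom C g; Cod C g = Dom C h\<rbrakk>
          \<Longrightarrow> Comp C h (Comp C g f) = Comp C (Comp C h g) f"

locale functor_between = C: category C + D: category D
  for C :: "('o1, 'm1, 'z1) category_scheme" and D :: "('o2, 'm2, 'z2) category_scheme" +
  fixes F_obj :: "'o1 \<Rightarrow> 'o2" and F_arr :: "'m1 \<Rightarrow> 'm2"
  assumes map_obj: "X \<in> Obj C \<Longrightarrow> F_obj X \<in> Obj D"
    and map_arr: "f \<in> Arr C \<Longrightarrow> F_arr f \<in> Arr D"
    and map_dom: "f \<in> Arr C \<Longrightarrow> Dom D (F_arr f) = F_obj (Dom C f)"
    and map_cod: "f \<in> Arr C \<Longrightarrow> Cod D (F_arr f) = F_obj (Cod C f)"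
    and map_ident: "X \<in> Obj C \<Longrightarrow> F_arr (Ident C X) = Ident D (F_obj X)"
    and map_comp: "\<lbrakk>f \<in> Arr C; g \<in> Arr C; Cod C f = Dom C g\<rbrakk>
          \<Longrightarrow> F_arr (Comp C g f) = Comp D (F_arr g) (F_arr f)"

(* Functors are given by total HOL functions, so their equality is equality
   on the objects and the arrows of the source category. *)
definition functor_eq ::
    "('o1, 'm1, 'z1) category_scheme \<Rightarrow> ('o1 \<Rightarrow> 'o2) \<times> ('m1 \<Rightarrow> 'm2) \<Rightarrow> ('o1 \<Rightarrow> 'o2) \<times> ('m1 \<Rightarrow> 'm2) \<Rightarrow> bool"
  where "functor_eq C F G \<longleftrightarrow>
    (\<forall>X \<in> Obj C. fst F X = fst G X) \<and> (\<forall>f \<in> Arr C. snd F f = snd G f)"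

definition isomorphic_categories ::
    "('o1, 'm1, 'z1) category_scheme \<Rightarrow> ('o2, 'm2, 'z2) category_scheme \<Rightarrow> bool"
  where "isomorphic_categories C D \<longleftrightarrow>
    (\<exists>F_obj F_arr G_obj G_arr.
       functor_between C D F_obj F_arr \<and>
       functor_between D C G_obj G_arr \<and>
       functor_eq C (G_obj \<circ> F_obj, G_arr \<circ> F_arr) (id, id) \<and>
       functor_eq D (F_obj \<circ> G_obj, F_arr \<circ> G_arr) (id, id))"

(* The category of a class of structured sets and structure-preserving maps.
   An arrow is a triple (A, h, B), so that it determines its source and target;
   the maps h are expected to be extensional on carrier A. *)
definition concrete_category ::
    "('a, 'b) partial_object_scheme set
     \<Rightarrow> (('a, 'b) partial_object_scheme \<Rightarrow> ('a, 'b) partial_object_scheme \<Rightarrow> ('a \<Rightarrow> 'a) set)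
     \<Rightarrow> (('a, 'b) partial_object_scheme,
         ('a, 'b) partial_object_scheme \<times> ('a \<Rightarrow> 'a) \<times> ('a, 'b) partial_object_scheme) category"
  where "concrete_category Objs Homs =
    \<lparr> Obj = Objs,
      Arr = {(A, h, B). A \<in> Objs \<and> B \<in> Objs \<and> h \<in> Homs A B},
      Dom = (\<lambda>(A, h, B). A),
      Cod = (\<lambda>(A, h, B). B),
      Ident = (\<lambda>A. (A, (\<lambda>x \<in> carrier A. x), A)),
      Comp = (\<lambda>(B, g, C) (A, f, B'). (A, compose (carrier A) g f, C)) \<rparr>"


section \<open>Bounded implication algebras\<close>

(* The operations are extensional: outside the carrier they take
   the value undefined.  Hence two structures are equal as records exactly if they have
   the same carrier, the same operations on it and the same constants. *)

record 'a implication_algebra = "'a partial_object" +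
  imp :: "'a \<Rightarrow> 'a \<Rightarrow> 'a"  (infixl \<open>\<cdot>\<index>\<close> 70)

record 'a bounded_implication_algebra = "'a implication_algebra" +
  const0 :: 'a  (\<open>c\<^sub>0\<index>\<close>)

locale implication_algebra =
  fixes A :: "('a, 'z) implication_algebra_scheme" (structure)
  assumes imp_closed: "imp A \<in> carrier A \<rightarrow>\<^sub>E carrier A \<rightarrow>\<^sub>E carrier A"
    and imp_contraction: "\<lbrakk>x \<in> carrier A; y \<in> carrier A\<rbrakk> \<Longrightarrow> (x \<cdot> y) \<cdot> x = x"
    and imp_quasi_comm: "\<lbrakk>x \<in> carrier A; y \<in> carrier A\<rbrakk> \<Longrightarrow> (x \<cdot> y) \<cdot> y = (y \<cdot> x) \<cdot> x"
    and imp_exchange: "\<lbrakk>x \<in> carrier A; y \<in> carrier A; z \<in> carrier A\<rbrakk>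
          \<Longrightarrow> x \<cdot> (y \<cdot> z) = y \<cdot> (x \<cdot> z)"

definition const1 :: "('a, 'z) implication_algebra_scheme \<Rightarrow> 'a"  (\<open>c\<^sub>1\<index>\<close>)
  where "c\<^sub>1\<^bsub>A\<^esub> = (THE c. \<forall>x \<in> carrier A. x \<cdot>\<^bsub>A\<^esub> x = c)"

locale bounded_implication_algebra = implication_algebra A
  for A :: "('a, 'z) bounded_implication_algebra_scheme" (structure) +
  assumes const0_closed: "c\<^sub>0 \<in> carrier A"
    and const0_imp: "x \<in> carrier A \<Longrightarrow> c\<^sub>0 \<cdot> x = c\<^sub>1"

lemma (in implication_algebra) imp_in_carrier:
  "\<lbrakk>x \<in> carrier A; y \<in> carrier A\<rbrakk> \<Longrightarrow> x \<cdot> y \<in> carrier A"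
  using imp_closed by (auto simp: PiE_iff)

lemma (in implication_algebra) imp_self_unique:
  assumes x: "x \<in> carrier A" and y: "y \<in> carrier A"
  shows "x \<cdot> x = y \<cdot> y"
  using imp_in_carrier imp_contraction imp_quasi_comm imp_exchange x y
  by (smt (verit, ccfv_threshold))

lemma (in implication_algebra) imp_self:
  assumes x: "x \<in> carrier A"
  shows "x \<cdot> x = c\<^sub>1"
proof -
  have "c\<^sub>1 = x \<cdot> x"
    unfolding const1_def
    by (rule the_equality, use x imp_self_unique in blast, use x in simp)
  then show ?thesis by simp
qed

definition bounded_implication_hom ::
    "('a, 'y) bounded_implication_algebra_scheme \<Rightarrow> ('b, 'z) bounded_implication_algebra_scheme
     \<Rightarrow> ('a \<Rightarrow> 'b) set"
  where "bounded_implication_hom A B =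
    {h \<in> carrier A \<rightarrow>\<^sub>E carrier B.
       (\<forall>x \<in> carrier A. \<forall>y \<in> carrier A. h (x \<cdot>\<^bsub>A\<^esub> y) = h x \<cdot>\<^bsub>B\<^esub> h y) \<and>
       h c\<^sub>0\<^bsub>A\<^esub> = c\<^sub>0\<^bsub>B\<^esub>}"


section \<open>Boolean algebras\<close>

(* Boolean algebras as bounded complemented distributive lattices on an arbitrary carrier
   (the type class boolean_algebra only covers whole types).
   The one-element algebra, in which bottom and top coincide, is included. *)

record 'a bool_alg = "'a partial_object" +
  bmeet :: "'a \<Rightarrow> 'a \<Rightarrow> 'a"  (infixl \<open>\<sqinter>\<index>\<close> 70)
  bjoin :: "'a \<Rightarrow> 'a \<Rightarrow> 'a"  (infixl \<open>\<squnion>\<index>\<close> 65)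
  bcompl :: "'a \<Rightarrow> 'a"  (\<open>\<sim>\<index> _\<close> [81] 80)
  bbot :: 'a  (\<open>\<bottom>\<index>\<close>)
  btop :: 'a  (\<open>\<top>\<index>\<close>)

locale bool_alg =
  fixes A :: "('a, 'z) bool_alg_scheme" (structure)
  assumes meet_closed: "bmeet A \<in> carrier A \<rightarrow>\<^sub>E carrier A \<rightarrow>\<^sub>E carrier A"
    and join_closed: "bjoin A \<in> carrier A \<rightarrow>\<^sub>E carrier A \<rightarrow>\<^sub>E carrier A"
    and compl_closed: "bcompl A \<in> carrier A \<rightarrow>\<^sub>E carrier A"
    and bot_closed: "\<bottom> \<in> carrier A"
    and top_closed: "\<top> \<in> carrier A"
    and meet_comm: "\<lbrakk>x \<in> carrier A; y \<in> carrier A\<rbrakk> \<Longrightarrow> x \<sqinter> y = y \<sqinter> x"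
    and join_comm: "\<lbrakk>x \<in> carrier A; y \<in> carrier A\<rbrakk> \<Longrightarrow> x \<squnion> y = y \<squnion> x"
    and meet_assoc: "\<lbrakk>x \<in> carrier A; y \<in> carrier A; z \<in> carrier A\<rbrakk>
          \<Longrightarrow> (x \<sqinter> y) \<sqinter> z = x \<sqinter> (y \<sqinter> z)"
    and join_assoc: "\<lbrakk>x \<in> carrier A; y \<in> carrier A; z \<in> carrier A\<rbrakk>
          \<Longrightarrow> (x \<squnion> y) \<squnion> z = x \<squnion> (y \<squnion> z)"
    and meet_absorb: "\<lbrakk>x \<in> carrier A; y \<in> carrier A\<rbrakk> \<Longrightarrow> x \<sqinter> (x \<squnion> y) = x"
    and join_absorb: "\<lbrakk>x \<in> carrier A; y \<in> carrier A\<rbrakk> \<Longrightarrow> x \<squnion> (x \<sqinter> y) = x"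
    and meet_distrib: "\<lbrakk>x \<in> carrier A; y \<in> carrier A; z \<in> carrier A\<rbrakk>
          \<Longrightarrow> x \<sqinter> (y \<squnion> z) = (x \<sqinter> y) \<squnion> (x \<sqinter> z)"
    and join_distrib: "\<lbrakk>x \<in> carrier A; y \<in> carrier A; z \<in> carrier A\<rbrakk>
          \<Longrightarrow> x \<squnion> (y \<sqinter> z) = (x \<squnion> y) \<sqinter> (x \<squnion> z)"
    and join_bot: "x \<in> carrier A \<Longrightarrow> x \<squnion> \<bottom> = x"
    and meet_top: "x \<in> carrier A \<Longrightarrow> x \<sqinter> \<top> = x"
    and meet_compl: "x \<in> carrier A \<Longrightarrow> x \<sqinter> (\<sim> x) = \<bottom>"
    and join_compl: "x \<in> carrier A \<Longrightarrow> x \<squnion> (\<sim> x) = \<top>"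

definition bool_alg_hom ::
    "('a, 'y) bool_alg_scheme \<Rightarrow> ('b, 'z) bool_alg_scheme \<Rightarrow> ('a \<Rightarrow> 'b) set"
  where "bool_alg_hom A B =
    {h \<in> carrier A \<rightarrow>\<^sub>E carrier B.
       (\<forall>x \<in> carrier A. \<forall>y \<in> carrier A. h (x \<sqinter>\<^bsub>A\<^esub> y) = h x \<sqinter>\<^bsub>B\<^esub> h y) \<and>
       (\<forall>x \<in> carrier A. \<forall>y \<in> carrier A. h (x \<squnion>\<^bsub>A\<^esub> y) = h x \<squnion>\<^bsub>B\<^esub> h y) \<and>
       (\<forall>x \<in> carrier A. h (\<sim>\<^bsub>A\<^esub> x) = \<sim>\<^bsub>B\<^esub> (h x)) \<and>
       h \<bottom>\<^bsub>A\<^esub> = \<bottom>\<^bsub>B\<^esub> \<and>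
       h \<top>\<^bsub>A\<^esub> = \<top>\<^bsub>B\<^esub>}"


section \<open>The two categories\<close>

(* HOL has no type of all sets.  The type variable 'a plays the role of the universe:
   the objects are all algebras whose carrier is any subset of 'a. *)

type_synonym 'a bounded_implication_arrow =
  "'a bounded_implication_algebra \<times> ('a \<Rightarrow> 'a) \<times> 'a bounded_implication_algebra"

type_synonym 'a bool_alg_arrow = "'a bool_alg \<times> ('a \<Rightarrow> 'a) \<times> 'a bool_alg"

definition IA01 :: "('a bounded_implication_algebra, 'a bounded_implication_arrow) category"
  where "IA01 = concrete_category {A. bounded_implication_algebra A} bounded_implication_hom"

definition BA :: "('a bool_alg, 'a bool_alg_arrow) category"
  where "BA = concrete_category {A. bool_alg A} bool_alg_hom"

end

theory Submission
  imports Defs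
begin

text \<open>
  In a bounded implication algebra \<open>x \<cdot> y = c\<^sub>1\<close> defines a partial order with least
  element \<open>c\<^sub>0\<close> and binary joins \<open>(x \<cdot> y) \<cdot> y\<close>. The map \<open>x \<mapsto> x \<cdot> c\<^sub>0\<close> is an antitone
  involution, so meets exist by De Morgan, and the exchange law says that \<open>x \<cdot> _\<close> is right adjoint
  to meeting with \<open>x\<close>, which gives distributivity. Conversely a Boolean algebra is an implication
  algebra under material implication. The two translations keep the carrier, are mutually
  inverse, and are given by terms, so that the homomorphisms on both sides are the same maps.
\<close>

section \<open>Concrete categories\<close>

text \<open>What \<open>concrete_category\<close> needs to be a category. The extensionality
  contained in \<open>hom_funcset\<close> lets the unit laws hold as equations between total
  functions.\<close>

locale concrete_homs =
  fixes Objs :: "('a, 'b) partial_object_scheme set"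
    and Homs :: "('a, 'b) partial_object_scheme \<Rightarrow> ('a, 'b) partial_object_scheme \<Rightarrow> ('a \<Rightarrow> 'a) set"
  assumes hom_funcset: "\<lbrakk>A \<in> Objs; B \<in> Objs; h \<in> Homs A B\<rbrakk> \<Longrightarrow> h \<in> carrier A \<rightarrow>\<^sub>E carrier B"
    and hom_ident: "A \<in> Objs \<Longrightarrow> (\<lambda>x \<in> carrier A. x) \<in> Homs A A"
    and hom_compose: "\<lbrakk>A \<in> Objs; B \<in> Objs; C \<in> Objs; f \<in> Homs A B; g \<in> Homs B C\<rbrakk>
          \<Longrightarrow> compose (carrier A) g f \<in> Homs A C"
begin

lemma category_concrete: "category (concrete_category Objs Homs)"
proof (unfold_locales, goal_cases)
  \<comment> \<open>Cases 9 and 10 are the unit laws; off the carrier both sides are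
    \<open>undefined\<close>.\<close>
  case (9 f)
  then show ?case
    by (fastforce simp: concrete_category_def compose_def restrict_def PiE_iff extensional_def
        dest: hom_funcset)
next
  case (10 f)
  then show ?case
    by (fastforce simp: concrete_category_def compose_def restrict_def PiE_iff extensional_def
        dest: hom_funcset)
next
  case (11 f g h)
  then show ?case
    by (fastforce simp: concrete_category_def compose_def restrict_def PiE_iff dest: hom_funcset)
qed (auto simp: concrete_category_def hom_ident hom_compose)

end

text \<open>As \<open>\<Phi>\<close> keeps carriers, the underlying maps can stay as they are:
  identities and composites depend on the structures only through their carriers.\<close>

lemma functor_concrete:
  assumes "concrete_homs Objs Homs" and "concrete_homs Objs' Homs'"
    and obj: "\<And>A. A \<in> Objs \<Longrightarrow> \<Phi> A \<in> Objs'"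
    and carrier: "\<And>A. A \<in> Objs \<Longrightarrow> carrier (\<Phi> A) = carrier A"
    and hom: "\<And>A B. \<lbrakk>A \<in> Objs; B \<in> Objs\<rbrakk> \<Longrightarrow> Homs A B \<subseteq> Homs' (\<Phi> A) (\<Phi> B)"
  shows "functor_between (concrete_category Objs Homs) (concrete_category Objs' Homs')
           \<Phi> (\<lambda>(A, h, B). (\<Phi> A, h, \<Phi> B))"
proof -
  interpret C: category "concrete_category Objs Homs"
    using assms(1) by (rule concrete_homs.category_concrete)
  interpret D: category "concrete_category Objs' Homs'"
    using assms(2) by (rule concrete_homs.category_concrete)
  show ?thesis
    by unfold_locales (use obj carrier subsetD[OF hom] in \<open>auto simp: concrete_category_def\<close>)
qed

text \<open>One equality of hom-sets serves both functors: for \<open>\<Psi>\<close> it is read at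
  \<open>\<Psi> A\<close> and \<open>\<Psi> B\<close> and simplified by
  \<open>\<Phi> (\<Psi> B) = B\<close>.\<close>

lemma isomorphic_concrete_categories:
  assumes C: "concrete_homs Objs Homs" and D: "concrete_homs Objs' Homs'"
    and obj: "\<And>A. A \<in> Objs \<Longrightarrow> \<Phi> A \<in> Objs'" "\<And>B. B \<in> Objs' \<Longrightarrow> \<Psi> B \<in> Objs"
    and inverse: "\<And>A. A \<in> Objs \<Longrightarrow> \<Psi> (\<Phi> A) = A" "\<And>B. B \<in> Objs' \<Longrightarrow> \<Phi> (\<Psi> B) = B"
    and carrier: "\<And>A. A \<in> Objs \<Longrightarrow> carrier (\<Phi> A) = carrier A"
    and hom: "\<And>A B. \<lbrakk>A \<in> Objs; B \<in> Objs\<rbrakk> \<Longrightarrow> Homs' (\<Phi> A) (\<Phi> B) = Homs A B"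
  shows "isomorphic_categories (concrete_category Objs Homs) (concrete_category Objs' Homs')"
proof -
  have carrier': "carrier (\<Psi> B) = carrier B" if "B \<in> Objs'" for B
    using carrier[of "\<Psi> B"] that obj inverse by simp
  have hom': "Homs A B \<subseteq> Homs' (\<Phi> A) (\<Phi> B)" if "A \<in> Objs" "B \<in> Objs" for A B
    using hom that by simp
  have hom'': "Homs' A B \<subseteq> Homs (\<Psi> A) (\<Psi> B)" if "A \<in> Objs'" "B \<in> Objs'" for A B
    using hom[of "\<Psi> A" "\<Psi> B"] that obj inverse by simp
  show ?thesis
    unfolding isomorphic_categories_def
  proof (intro exI conjI)
    show "functor_between (concrete_category Objs Homs) (concrete_category Objs' Homs')
            \<Phi> (\<lambda>(A, h, B). (\<Phi> A, h, \<Phi> B))"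
      using functor_concrete[OF C D obj(1) carrier hom'] .
    show "functor_between (concrete_category Objs' Homs') (concrete_category Objs Homs)
            \<Psi> (\<lambda>(A, h, B). (\<Psi> A, h, \<Psi> B))"
      using functor_concrete[OF D C obj(2) carrier' hom''] .
  qed (auto simp: functor_eq_def concrete_category_def inverse)
qed


section \<open>From implication algebras to Boolean algebras\<close>

context implication_algebra
begin

definition le :: "'a \<Rightarrow> 'a \<Rightarrow> bool"  (infix \<open>\<preceq>\<close> 50)
  where "x \<preceq> y \<longleftrightarrow> x \<cdot> y = c\<^sub>1"

definition join :: "'a \<Rightarrow> 'a \<Rightarrow> 'a"  (infixl \<open>\<or>\<or>\<close> 65)
  where "x \<or>\<or> y = (x \<cdot> y) \<cdot> y"

text \<open>The element \<open>x\<close> guarantees a nonempty carrier; without a constant an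
  implication algebra may be empty.\<close>

lemma const1_closed: "x \<in> carrier A \<Longrightarrow> c\<^sub>1 \<in> carrier A"
  using imp_in_carrier imp_self by metis

lemma join_in_carrier: "\<lbrakk>x \<in> carrier A; y \<in> carrier A\<rbrakk> \<Longrightarrow> x \<or>\<or> y \<in> carrier A"
  by (simp add: join_def imp_in_carrier)

lemma const1_imp: "x \<in> carrier A \<Longrightarrow> c\<^sub>1 \<cdot> x = x"
  using imp_contraction imp_self by metis

lemma imp_const1: "x \<in> carrier A \<Longrightarrow> x \<cdot> c\<^sub>1 = c\<^sub>1"
  using imp_contraction[of "c\<^sub>1" x] const1_imp const1_closed by metis

text \<open>Contraction for the pair \<open>x \<cdot> y\<close>, \<open>x\<close>, whose inner part
  \<open>(x \<cdot> y) \<cdot> x\<close> is \<open>x\<close> by contraction again.\<close>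

lemma imp_imp_same: "\<lbrakk>x \<in> carrier A; y \<in> carrier A\<rbrakk> \<Longrightarrow> x \<cdot> (x \<cdot> y) = x \<cdot> y"
  using imp_contraction imp_in_carrier by metis

lemma join_commute: "\<lbrakk>x \<in> carrier A; y \<in> carrier A\<rbrakk> \<Longrightarrow> x \<or>\<or> y = y \<or>\<or> x"
  by (simp add: join_def imp_quasi_comm)

lemma le_refl: "x \<in> carrier A \<Longrightarrow> x \<preceq> x"
  by (simp add: le_def imp_self)

text \<open>Quasi-commutativity collapses on both sides: \<open>(x \<cdot> y) \<cdot> y\<close> to
  \<open>y\<close> and \<open>(y \<cdot> x) \<cdot> x\<close> to \<open>x\<close>.\<close>

lemma le_antisym: "\<lbrakk>x \<in> carrier A; y \<in> carrier A; x \<preceq> y; y \<preceq> x\<rbrakk> \<Longrightarrow> x = y"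
  using imp_quasi_comm const1_imp unfolding le_def by metis

lemma le_imp_join: "\<lbrakk>x \<in> carrier A; y \<in> carrier A; x \<preceq> y\<rbrakk> \<Longrightarrow> x \<or>\<or> y = y"
  by (simp add: join_def le_def const1_imp)

lemma le_imp: "\<lbrakk>x \<in> carrier A; y \<in> carrier A\<rbrakk> \<Longrightarrow> y \<preceq> x \<cdot> y"
  using imp_exchange[of y x y] by (simp add: le_def imp_self imp_const1)

text \<open>Writing \<open>z\<close> as \<open>z \<or>\<or> y\<close> and exchanging turns
  \<open>x \<cdot> z\<close> into \<open>(z \<cdot> y) \<cdot> (x \<cdot> y)\<close>, which lies
  above \<open>x \<cdot> y\<close> by \<open>le_imp\<close>.\<close>

lemma imp_mono:
  assumes "x \<in> carrier A" "y \<in> carrier A" "z \<in> carrier A" "y \<preceq> z"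
  shows "x \<cdot> y \<preceq> x \<cdot> z"
proof -
  have "x \<cdot> z = x \<cdot> (z \<or>\<or> y)"
    using le_imp_join[of y z] join_commute assms by simp
  also have "\<dots> = (z \<cdot> y) \<cdot> (x \<cdot> y)"
    using assms by (simp add: join_def imp_exchange imp_in_carrier)
  finally show ?thesis
    using assms by (simp add: le_imp imp_in_carrier)
qed

text \<open>Monotonicity comes first: with \<open>x \<cdot> y = c\<^sub>1\<close> it says that
  \<open>x \<cdot> z\<close> is above \<open>c\<^sub>1\<close>, hence equal to it.\<close>

lemma le_trans:
  assumes "x \<in> carrier A" "y \<in> carrier A" "z \<in> carrier A" and "x \<preceq> y" and "y \<preceq> z"
  shows "x \<preceq> z"
  using imp_mono[of x y z] assms by (simp add: le_def const1_imp imp_in_carrier)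

lemma le_join1: "\<lbrakk>x \<in> carrier A; y \<in> carrier A\<rbrakk> \<Longrightarrow> x \<preceq> x \<or>\<or> y"
  using imp_exchange[of x "x \<cdot> y" y] by (simp add: le_def join_def imp_self imp_in_carrier)

lemma le_join2: "\<lbrakk>x \<in> carrier A; y \<in> carrier A\<rbrakk> \<Longrightarrow> y \<preceq> x \<or>\<or> y"
  using le_join1[of y x] join_commute[of x y] by simp

text \<open>Exchange rewrites \<open>(y \<cdot> z) \<cdot> (x \<cdot> z)\<close> as
  \<open>x \<cdot> (y \<or>\<or> z)\<close>, so the claim amounts to
  \<open>x \<preceq> y \<or>\<or> z\<close>.\<close>

lemma imp_antimono:
  assumes "x \<in> carrier A" "y \<in> carrier A" "z \<in> carrier A" "x \<preceq> y"
  shows "y \<cdot> z \<preceq> x \<cdot> z"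
proof -
  have "x \<preceq> y \<or>\<or> z"
    using assms le_trans[of x y "y \<or>\<or> z"] by (simp add: le_join1 join_in_carrier)
  then show ?thesis
    using assms imp_exchange[of "y \<cdot> z" x z] by (simp add: le_def join_def imp_in_carrier)
qed

text \<open>Two uses of \<open>imp_antimono\<close> carry \<open>x \<preceq> z\<close> to
  \<open>(x \<cdot> y) \<cdot> y \<preceq> (z \<cdot> y) \<cdot> y\<close>, and the right side is
  \<open>z\<close> because \<open>y \<preceq> z\<close>.\<close>

lemma join_least:
  assumes xyz: "x \<in> carrier A" "y \<in> carrier A" "z \<in> carrier A" and "x \<preceq> z" and "y \<preceq> z"
  shows "x \<or>\<or> y \<preceq> z"
proof -
  have "x \<or>\<or> y \<preceq> z \<or>\<or> y"
    unfolding join_def using assms by (intro imp_antimono imp_in_carrier)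
  also have "z \<or>\<or> y = z"
    using le_imp_join[of y z] join_commute assms by simp
  finally show ?thesis .
qed

lemma join_le_iff:
  "\<lbrakk>x \<in> carrier A; y \<in> carrier A; z \<in> carrier A\<rbrakk> \<Longrightarrow> x \<or>\<or> y \<preceq> z \<longleftrightarrow> x \<preceq> z \<and> y \<preceq> z"
  using join_least[of x y z] le_trans[of x "x \<or>\<or> y" z] le_trans[of y "x \<or>\<or> y" z]
  by (auto simp: join_in_carrier le_join1 le_join2)

text \<open>Reduces equations between joins to equivalences of inequalities; associativity and, with
  residuation, distributivity are proved this way.\<close>

lemma eqI_upper_bounds:
  assumes "x \<in> carrier A" "y \<in> carrier A" and "\<And>z. z \<in> carrier A \<Longrightarrow> x \<preceq> z \<longleftrightarrow> y \<preceq> z"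
  shows "x = y"
  using le_antisym[of x y] le_refl[of x] le_refl[of y] assms by simp

lemma join_associative:
  assumes "x \<in> carrier A" "y \<in> carrier A" "z \<in> carrier A"
  shows "(x \<or>\<or> y) \<or>\<or> z = x \<or>\<or> (y \<or>\<or> z)"
  using assms by (intro eqI_upper_bounds) (auto simp: join_in_carrier join_le_iff)

end

section \<open>Complements, meets and distributivity in the bounded case\<close>

context bounded_implication_algebra
begin

definition compl :: "'a \<Rightarrow> 'a"
  where "compl x = x \<cdot> c\<^sub>0"

definition meet :: "'a \<Rightarrow> 'a \<Rightarrow> 'a"  (infixl \<open>\<and>\<and>\<close> 70)
  where "x \<and>\<and> y = compl (compl x \<or>\<or> compl y)"

lemmas closed = imp_in_carrier join_in_carrier const0_closed const1_closed[OF const0_closed]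

lemma compl_in_carrier: "x \<in> carrier A \<Longrightarrow> compl x \<in> carrier A"
  by (simp add: compl_def closed)

lemma meet_in_carrier: "\<lbrakk>x \<in> carrier A; y \<in> carrier A\<rbrakk> \<Longrightarrow> x \<and>\<and> y \<in> carrier A"
  by (simp add: meet_def closed compl_in_carrier)

text \<open>Quasi-commutativity with \<open>c\<^sub>0\<close>: \<open>(x \<cdot> c\<^sub>0) \<cdot>
  c\<^sub>0 = (c\<^sub>0 \<cdot> x) \<cdot> x = c\<^sub>1 \<cdot> x\<close>.\<close>

lemma compl_compl: "x \<in> carrier A \<Longrightarrow> compl (compl x) = x"
  using imp_quasi_comm[of x "c\<^sub>0"] by (simp add: compl_def const0_closed const0_imp const1_imp)

lemma compl_const0: "compl c\<^sub>0 = c\<^sub>1"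
  by (simp add: compl_def imp_self const0_closed)

lemma compl_const1: "compl c\<^sub>1 = c\<^sub>0"
  by (simp add: compl_def const1_imp const0_closed)

lemma compl_antimono: "\<lbrakk>x \<in> carrier A; y \<in> carrier A; x \<preceq> y\<rbrakk> \<Longrightarrow> compl y \<preceq> compl x"
  by (simp add: compl_def imp_antimono const0_closed)

lemma compl_le_swap:
  "\<lbrakk>x \<in> carrier A; y \<in> carrier A\<rbrakk> \<Longrightarrow> compl x \<preceq> y \<longleftrightarrow> compl y \<preceq> x"
  using compl_antimono[of "compl x" y] compl_antimono[of "compl y" x]
  by (auto simp: compl_compl compl_in_carrier)

lemma compl_le_compl_iff:
  "\<lbrakk>x \<in> carrier A; y \<in> carrier A\<rbrakk> \<Longrightarrow> compl x \<preceq> compl y \<longleftrightarrow> y \<preceq> x"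
  using compl_le_swap[of x "compl y"] by (simp add: compl_compl compl_in_carrier)

lemma compl_join: "\<lbrakk>x \<in> carrier A; y \<in> carrier A\<rbrakk> \<Longrightarrow> compl (x \<or>\<or> y) = compl x \<and>\<and> compl y"
  by (simp add: meet_def compl_compl)

lemma compl_meet: "\<lbrakk>x \<in> carrier A; y \<in> carrier A\<rbrakk> \<Longrightarrow> compl (x \<and>\<and> y) = compl x \<or>\<or> compl y"
  by (simp add: meet_def compl_compl closed compl_in_carrier)

text \<open>The dual of \<open>join_le_iff\<close> under the order-reversing involution
  \<open>compl\<close>.\<close>

lemma le_meet_iff:
  assumes "x \<in> carrier A" "y \<in> carrier A" "z \<in> carrier A"
  shows "z \<preceq> x \<and>\<and> y \<longleftrightarrow> z \<preceq> x \<and> z \<preceq> y"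
  using assms compl_le_compl_iff[of "x \<and>\<and> y" z]
  by (simp add: meet_in_carrier compl_meet join_le_iff compl_in_carrier compl_le_compl_iff)

lemma meet_le1: "\<lbrakk>x \<in> carrier A; y \<in> carrier A\<rbrakk> \<Longrightarrow> x \<and>\<and> y \<preceq> x"
  using le_meet_iff[of x y "x \<and>\<and> y"] by (simp add: meet_in_carrier le_refl)

lemma meet_commute: "\<lbrakk>x \<in> carrier A; y \<in> carrier A\<rbrakk> \<Longrightarrow> x \<and>\<and> y = y \<and>\<and> x"
  by (simp add: meet_def join_commute compl_in_carrier)

lemma meet_associative:
  assumes "x \<in> carrier A" "y \<in> carrier A" "z \<in> carrier A"
  shows "(x \<and>\<and> y) \<and>\<and> z = x \<and>\<and> (y \<and>\<and> z)"
  using assms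
  by (simp add: meet_def compl_compl closed compl_in_carrier join_associative)

lemma join_meet_absorb: "\<lbrakk>x \<in> carrier A; y \<in> carrier A\<rbrakk> \<Longrightarrow> x \<or>\<or> (x \<and>\<and> y) = x"
  by (metis join_commute le_imp_join meet_in_carrier meet_le1)

lemma meet_join_absorb:
  assumes "x \<in> carrier A" "y \<in> carrier A"
  shows "x \<and>\<and> (x \<or>\<or> y) = x"
  using assms join_meet_absorb[of "compl x" "compl y"]
  by (simp add: meet_def compl_compl compl_in_carrier)

text \<open>By \<open>imp_imp_same\<close> the join unfolds to an element of the form
  \<open>u \<cdot> u\<close>.\<close>

lemma join_compl_self: "x \<in> carrier A \<Longrightarrow> x \<or>\<or> compl x = c\<^sub>1"
  by (simp add: join_def compl_def imp_imp_same imp_self closed)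

lemma meet_compl_self: "x \<in> carrier A \<Longrightarrow> x \<and>\<and> compl x = c\<^sub>0"
  using join_compl_self[of "compl x"] by (simp add: meet_def compl_const1 compl_in_carrier)

lemma join_const0: "x \<in> carrier A \<Longrightarrow> x \<or>\<or> c\<^sub>0 = x"
  using compl_compl by (simp add: compl_def join_def)

lemma meet_const1: "x \<in> carrier A \<Longrightarrow> x \<and>\<and> c\<^sub>1 = x"
  by (simp add: meet_def compl_const1 join_const0 compl_compl compl_in_carrier)

text \<open>Recovers implication from the Boolean operations; residuation, one round trip and the
  comparison of homomorphisms rest on it.\<close>

lemma compl_join_imp:
  assumes xy: "x \<in> carrier A" "y \<in> carrier A"
  shows "compl x \<or>\<or> y = x \<cdot> y"
proof (rule le_antisym)
  have "compl x \<preceq> x \<cdot> y"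
    using xy imp_mono[of x "c\<^sub>0" y] by (simp add: compl_def le_def closed const0_imp)
  then show "compl x \<or>\<or> y \<preceq> x \<cdot> y"
    using xy by (simp add: join_le_iff compl_in_carrier closed le_imp)
  \<comment> \<open>For the converse, \<open>x \<or>\<or> ?z\<close> is \<open>c\<^sub>1\<close>
    because \<open>?z\<close> already lies above \<open>compl x\<close>.\<close>
  let ?z = "compl x \<or>\<or> y"
  have z: "?z \<in> carrier A" "compl x \<preceq> ?z" "y \<preceq> ?z"
    using xy by (simp_all add: closed compl_in_carrier le_join1 le_join2)
  have "x \<or>\<or> compl x \<preceq> x \<or>\<or> ?z"
    using xy z le_trans[of "compl x" ?z "x \<or>\<or> ?z"]
    by (simp add: join_le_iff closed compl_in_carrier le_join1 le_join2)
  then have "x \<or>\<or> ?z = c\<^sub>1"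
    using xy z by (simp add: join_compl_self le_def const1_imp closed)
  \<comment> \<open>Unfolding the join, the equation just obtained is
    \<open>(x \<cdot> ?z) \<cdot> ?z = c\<^sub>1\<close>.\<close>
  then have "x \<cdot> ?z \<preceq> ?z"
    by (simp only: le_def join_def)
  moreover have "x \<cdot> y \<preceq> x \<cdot> ?z"
    using xy z by (simp add: imp_mono)
  ultimately show "x \<cdot> y \<preceq> ?z"
    using xy z le_trans[of "x \<cdot> y" "x \<cdot> ?z" ?z] by (simp add: closed)
qed (use xy in \<open>simp_all add: closed compl_in_carrier\<close>)

text \<open>Residuation. Complementing turns the meet into a join, hence into an implication, where
  exchange can bring \<open>y\<close> to the front.\<close>

lemma meet_le_iff_le_imp:
  assumes "x \<in> carrier A" "y \<in> carrier A" "z \<in> carrier A"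
  shows "x \<and>\<and> y \<preceq> z \<longleftrightarrow> y \<preceq> x \<cdot> z"
proof -
  have "x \<and>\<and> y \<preceq> z \<longleftrightarrow> compl z \<preceq> compl x \<or>\<or> compl y"
    using assms compl_le_compl_iff[of z "x \<and>\<and> y"] by (simp add: meet_in_carrier compl_meet)
  also have "\<dots> \<longleftrightarrow> compl z \<preceq> y \<cdot> compl x"
    using assms compl_join_imp[of y "compl x"] join_commute by (simp add: compl_in_carrier)
  also have "\<dots> \<longleftrightarrow> y \<preceq> compl z \<cdot> compl x"
    using assms imp_exchange by (simp add: le_def compl_in_carrier)
  \<comment> \<open>Contraposition is exchange with last argument \<open>c\<^sub>0\<close>, followed
    by double complement.\<close>
  also have "compl z \<cdot> compl x = x \<cdot> z"
    using assms imp_exchange[of "compl z" x "c\<^sub>0"] compl_compl[of z]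
    by (simp add: compl_def closed)
  finally show ?thesis .
qed

text \<open>Meeting with \<open>x\<close> is a left adjoint, so it preserves joins; both sides have
  the same upper bounds.\<close>

lemma meet_join_distrib:
  assumes xyz: "x \<in> carrier A" "y \<in> carrier A" "z \<in> carrier A"
  shows "x \<and>\<and> (y \<or>\<or> z) = (x \<and>\<and> y) \<or>\<or> (x \<and>\<and> z)"
  using xyz
  by (intro eqI_upper_bounds) (auto simp: closed meet_in_carrier join_le_iff meet_le_iff_le_imp)

lemma join_meet_distrib:
  assumes "x \<in> carrier A" "y \<in> carrier A" "z \<in> carrier A"
  shows "x \<or>\<or> (y \<and>\<and> z) = (x \<or>\<or> y) \<and>\<and> (x \<or>\<or> z)"
proof -
  have "compl (x \<or>\<or> (y \<and>\<and> z)) = compl ((x \<or>\<or> y) \<and>\<and> (x \<or>\<or> z))"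
    using assms meet_join_distrib[of "compl x" "compl y" "compl z"]
    by (simp add: compl_join compl_meet closed meet_in_carrier compl_in_carrier)
  then show ?thesis
    using assms by (metis compl_compl join_in_carrier meet_in_carrier)
qed

end

text \<open>The restricted abstractions give the extensionality that \<open>bool_alg\<close>
  demands, so that the round trips can be equalities of records.\<close>

definition bool_alg_of :: "('a, 'z) bounded_implication_algebra_scheme \<Rightarrow> 'a bool_alg"
  where "bool_alg_of A =
    \<lparr> carrier = carrier A,
      bmeet = (\<lambda>x \<in> carrier A. \<lambda>y \<in> carrier A. bounded_implication_algebra.meet A x y),
      bjoin = (\<lambda>x \<in> carrier A. \<lambda>y \<in> carrier A. implication_algebra.join A x y),
      bcompl = (\<lambda>x \<in> carrier A. bounded_implication_algebra.compl A x),
      bbot = c\<^sub>0\<^bsub>A\<^esub>,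
      btop = c\<^sub>1\<^bsub>A\<^esub> \<rparr>"

lemma carrier_bool_alg_of [simp]: "carrier (bool_alg_of A) = carrier A"
  by (simp add: bool_alg_of_def)

lemma (in bounded_implication_algebra) bool_alg_bool_alg_of: "bool_alg (bool_alg_of A)"
  by (unfold_locales; simp add: bool_alg_of_def closed meet_in_carrier compl_in_carrier
      join_const0 meet_const1 meet_compl_self join_compl_self)
    (intro meet_commute join_commute meet_associative join_associative meet_join_absorb
      join_meet_absorb meet_join_distrib join_meet_distrib; assumption)+


section \<open>From Boolean algebras to implication algebras\<close>

context bool_alg
begin

lemma meet_in_carrier: "\<lbrakk>x \<in> carrier A; y \<in> carrier A\<rbrakk> \<Longrightarrow> x \<sqinter> y \<in> carrier A"
  using meet_closed by (auto simp: PiE_iff)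

lemma join_in_carrier: "\<lbrakk>x \<in> carrier A; y \<in> carrier A\<rbrakk> \<Longrightarrow> x \<squnion> y \<in> carrier A"
  using join_closed by (auto simp: PiE_iff)

lemma compl_in_carrier: "x \<in> carrier A \<Longrightarrow> \<sim> x \<in> carrier A"
  using compl_closed by (auto simp: PiE_iff)

lemmas closed = meet_in_carrier join_in_carrier compl_in_carrier bot_closed top_closed

lemma compl_join: "x \<in> carrier A \<Longrightarrow> \<sim> x \<squnion> x = \<top>"
  by (simp add: join_comm[of "\<sim> x"] join_compl closed)

lemma compl_meet: "x \<in> carrier A \<Longrightarrow> \<sim> x \<sqinter> x = \<bottom>"
  by (simp add: meet_comm[of "\<sim> x"] meet_compl closed)

lemma bot_join: "x \<in> carrier A \<Longrightarrow> \<bottom> \<squnion> x = x"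
  by (simp add: join_comm[of "\<bottom>" x] join_bot closed)

text \<open>Absorption gives \<open>\<top> \<sqinter> (\<top> \<squnion> x) = \<top>\<close>, and
  \<open>\<top>\<close> is neutral for meets.\<close>

lemma join_top:
  assumes x: "x \<in> carrier A"
  shows "x \<squnion> \<top> = \<top>"
proof -
  have "\<top> \<squnion> x = (\<top> \<squnion> x) \<sqinter> \<top>"
    using x by (simp add: meet_top closed)
  also have "\<dots> = \<top> \<sqinter> (\<top> \<squnion> x)"
    using x by (intro meet_comm closed)
  also have "\<dots> = \<top>"
    using x by (intro meet_absorb closed)
  finally show ?thesis
    using x by (simp add: join_comm[of x] closed)
qed

lemma meet_bot:
  assumes x: "x \<in> carrier A"
  shows "x \<sqinter> \<bottom> = \<bottom>"
proof -
  have "\<bottom> \<sqinter> x = \<bottom> \<squnion> (\<bottom> \<sqinter> x)"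
    using x by (simp add: bot_join closed)
  also have "\<dots> = \<bottom>"
    using x by (intro join_absorb closed)
  finally show ?thesis
    using x by (simp add: meet_comm[of x] closed)
qed

text \<open>Both \<open>\<sim> x\<close> and \<open>y\<close> equal
  \<open>\<sim> x \<sqinter> y\<close>, by distributing over \<open>x \<squnion> y = \<top>\<close>
  and \<open>x \<squnion> \<sim> x = \<top>\<close>.\<close>

lemma compl_unique:
  assumes xy: "x \<in> carrier A" "y \<in> carrier A" and "x \<sqinter> y = \<bottom>" and "x \<squnion> y = \<top>"
  shows "\<sim> x = y"
proof -
  have "\<sim> x = \<sim> x \<sqinter> (x \<squnion> y)"
    using assms by (simp add: meet_top closed)
  also have "\<dots> = \<sim> x \<sqinter> y"
    using xy by (simp add: meet_distrib compl_meet bot_join closed)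
  also have "\<dots> = y \<sqinter> (x \<squnion> \<sim> x)"
    using assms by (simp add: meet_distrib meet_comm[of y] bot_join closed)
  also have "\<dots> = y"
    using xy by (simp add: join_compl meet_top)
  finally show ?thesis .
qed

lemma compl_compl: "x \<in> carrier A \<Longrightarrow> \<sim> (\<sim> x) = x"
  by (rule compl_unique) (simp_all add: closed compl_join compl_meet)

lemma de_morgan_join:
  assumes xy: "x \<in> carrier A" "y \<in> carrier A"
  shows "\<sim> (x \<squnion> y) = \<sim> x \<sqinter> \<sim> y"
proof (rule compl_unique)
  have "x \<sqinter> (\<sim> x \<sqinter> \<sim> y) = \<sim> y \<sqinter> (x \<sqinter> \<sim> x)"
    using xy by (simp add: meet_assoc meet_comm[of "\<sim> y"] closed)
  moreover have "y \<sqinter> (\<sim> x \<sqinter> \<sim> y) = \<sim> x \<sqinter> (y \<sqinter> \<sim> y)"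
    using xy by (simp add: meet_assoc[symmetric] meet_comm[of y "\<sim> x"] closed)
  ultimately show "(x \<squnion> y) \<sqinter> (\<sim> x \<sqinter> \<sim> y) = \<bottom>"
    using xy meet_distrib[of "\<sim> x \<sqinter> \<sim> y" x y]
    by (simp add: meet_comm[of "\<sim> x \<sqinter> \<sim> y"] meet_compl meet_bot join_bot closed)
  have "(x \<squnion> y) \<squnion> \<sim> x = y \<squnion> (x \<squnion> \<sim> x)"
    using xy by (simp add: join_assoc[symmetric] join_comm[of y x] closed)
  moreover have "(x \<squnion> y) \<squnion> \<sim> y = x \<squnion> (y \<squnion> \<sim> y)"
    using xy by (simp add: join_assoc closed)
  ultimately show "(x \<squnion> y) \<squnion> (\<sim> x \<sqinter> \<sim> y) = \<top>"
    using xy by (simp add: join_distrib join_compl join_top closed meet_top)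
qed (use xy in \<open>simp_all add: closed\<close>)

lemma de_morgan_implication:
  "\<lbrakk>x \<in> carrier A; y \<in> carrier A\<rbrakk> \<Longrightarrow> \<sim> (\<sim> x \<squnion> y) = x \<sqinter> \<sim> y"
  by (simp add: de_morgan_join closed compl_compl)

text \<open>The right side is symmetric, which yields quasi-commutativity of material implication;
  it also identifies the join of the translated algebra.\<close>

lemma implication_implication:
  assumes xy: "x \<in> carrier A" "y \<in> carrier A"
  shows "\<sim> (\<sim> x \<squnion> y) \<squnion> y = x \<squnion> y"
proof -
  have "\<sim> (\<sim> x \<squnion> y) \<squnion> y = y \<squnion> (x \<sqinter> \<sim> y)"
    using xy by (simp add: de_morgan_implication closed join_comm[of "x \<sqinter> \<sim> y"])
  also have "\<dots> = y \<squnion> x"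
    using xy by (simp add: join_distrib join_compl closed meet_top)
  also have "\<dots> = x \<squnion> y"
    using xy by (rule join_comm[rotated])
  finally show ?thesis .
qed

lemma meet_eq_compl_join_compl:
  "\<lbrakk>x \<in> carrier A; y \<in> carrier A\<rbrakk> \<Longrightarrow> x \<sqinter> y = \<sim> (\<sim> x \<squnion> \<sim> y)"
  by (simp add: de_morgan_join closed compl_compl)

end

section \<open>Material implication and its derived operations\<close>

definition implication_algebra_of :: "('a, 'z) bool_alg_scheme \<Rightarrow> 'a bounded_implication_algebra"
  where "implication_algebra_of A =
    \<lparr> carrier = carrier A,
      imp = (\<lambda>x \<in> carrier A. \<lambda>y \<in> carrier A. \<sim>\<^bsub>A\<^esub> x \<squnion>\<^bsub>A\<^esub> y),
      const0 = \<bottom>\<^bsub>A\<^esub> \<rparr>"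

lemma carrier_implication_algebra_of [simp]: "carrier (implication_algebra_of A) = carrier A"
  by (simp add: implication_algebra_of_def)

context bool_alg
begin

lemma implication_algebra_implication_algebra_of:
  "implication_algebra (implication_algebra_of A)"
proof (unfold_locales, goal_cases)
  case 1
  show ?case
    by (auto simp: implication_algebra_of_def closed)
next
  \<comment> \<open>Contraction is absorption, since \<open>\<sim> (\<sim> x \<squnion> y)\<close>
    is \<open>x \<sqinter> \<sim> y\<close>.\<close>
  case (2 x y)
  then have "\<sim> (\<sim> x \<squnion> y) \<squnion> x = x"
    by (simp add: de_morgan_implication closed join_comm[of "x \<sqinter> \<sim> y"] join_absorb)
  with 2 show ?case
    by (simp add: implication_algebra_of_def closed)
next
  case (3 x y)
  then show ?case
    by (simp add: implication_algebra_of_def closed implication_implication join_comm[of x y])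
next
  case (4 x y z)
  then have "\<sim> x \<squnion> (\<sim> y \<squnion> z) = \<sim> y \<squnion> (\<sim> x \<squnion> z)"
    by (simp add: join_assoc[symmetric] join_comm[of "\<sim> x" "\<sim> y"] closed)
  with 4 show ?case
    by (simp add: implication_algebra_of_def closed)
qed

text \<open>The value is computed at \<open>\<bottom>\<close>, where \<open>x \<cdot> x\<close> is
  \<open>\<sim> \<bottom> \<squnion> \<bottom>\<close>.\<close>

lemma const1_implication_algebra_of: "c\<^sub>1\<^bsub>implication_algebra_of A\<^esub> = \<top>"
  using implication_algebra.imp_self[OF implication_algebra_implication_algebra_of, of "\<bottom>"]
  by (simp add: implication_algebra_of_def bot_closed compl_join)

lemma bounded_implication_algebra_of:
  "bounded_implication_algebra (implication_algebra_of A)"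
proof -
  have "\<sim> \<bottom> \<squnion> x = \<top>" if "x \<in> carrier A" for x
    using that compl_unique[of "\<bottom>" "\<top>"] join_comm[of "\<top>" x]
    by (simp add: closed meet_top join_top)
  moreover have "implication_algebra (implication_algebra_of A)"
    by (rule implication_algebra_implication_algebra_of)
  ultimately show ?thesis
    using const1_implication_algebra_of
    by (simp add: bounded_implication_algebra_def bounded_implication_algebra_axioms_def
        implication_algebra_of_def bot_closed)
qed

lemma join_implication_algebra_of:
  "\<lbrakk>x \<in> carrier A; y \<in> carrier A\<rbrakk> \<Longrightarrow>
    implication_algebra.join (implication_algebra_of A) x y = x \<squnion> y"
  by (simp add: implication_algebra.join_def[OF implication_algebra_implication_algebra_of])
    (simp add: implication_algebra_of_def closed implication_implication)

lemma compl_implication_algebra_of: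
  "x \<in> carrier A \<Longrightarrow> bounded_implication_algebra.compl (implication_algebra_of A) x = \<sim> x"
  by (simp add: bounded_implication_algebra.compl_def[OF bounded_implication_algebra_of])
    (simp add: implication_algebra_of_def closed join_bot)

lemma meet_implication_algebra_of:
  "\<lbrakk>x \<in> carrier A; y \<in> carrier A\<rbrakk> \<Longrightarrow>
    bounded_implication_algebra.meet (implication_algebra_of A) x y = x \<sqinter> y"
  by (simp add: bounded_implication_algebra.meet_def[OF bounded_implication_algebra_of]
      compl_implication_algebra_of join_implication_algebra_of closed meet_eq_compl_join_compl)

end

section \<open>The two translations are mutually inverse\<close>

lemma PiE2_eqI:
  assumes "f \<in> X \<rightarrow>\<^sub>E X \<rightarrow>\<^sub>E Y" and "\<And>x y. \<lbrakk>x \<in> X; y \<in> X\<rbrakk> \<Longrightarrow> g x y = f x y"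
  shows "(\<lambda>x \<in> X. \<lambda>y \<in> X. g x y) = f"
proof (intro ext)
  fix x y
  show "(\<lambda>x \<in> X. \<lambda>y \<in> X. g x y) x y = f x y"
    using assms by (cases "x \<in> X"; cases "y \<in> X") (auto simp: PiE_iff extensional_def)
qed

text \<open>The type of \<open>B\<close> excludes further record fields, so agreement of all the
  fields gives equality; \<open>PiE2_eqI\<close> handles arguments off the carrier.\<close>

lemma bool_alg_of_implication_algebra_of:
  fixes B :: "'a bool_alg"
  assumes "bool_alg B"
  shows "bool_alg_of (implication_algebra_of B) = B"
proof -
  interpret bool_alg B by fact
  have "(\<lambda>x \<in> carrier B. bounded_implication_algebra.compl (implication_algebra_of B) x) = bcompl B"
    using compl_closed by (auto simp: fun_eq_iff PiE_iff extensional_def compl_implication_algebra_of)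
  then show ?thesis
    unfolding bool_alg_of_def carrier_implication_algebra_of
    by (simp add: PiE2_eqI[OF meet_closed] PiE2_eqI[OF join_closed] meet_implication_algebra_of
        join_implication_algebra_of const1_implication_algebra_of)
      (simp add: implication_algebra_of_def)
qed

lemma implication_algebra_of_bool_alg_of:
  fixes A :: "'a bounded_implication_algebra"
  assumes "bounded_implication_algebra A"
  shows "implication_algebra_of (bool_alg_of A) = A"
proof -
  interpret bounded_implication_algebra A by fact
  have "(\<lambda>x \<in> carrier A. \<lambda>y \<in> carrier A. bjoin (bool_alg_of A) (bcompl (bool_alg_of A) x) y) = imp A"
    by (rule PiE2_eqI[OF imp_closed]) (simp add: bool_alg_of_def compl_in_carrier compl_join_imp)
  then show ?thesis
    unfolding implication_algebra_of_def by (simp add: bool_alg_of_def)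
qed


section \<open>Homomorphisms\<close>

lemma concrete_homs_bounded_implication:
  "concrete_homs {A :: 'a bounded_implication_algebra. bounded_implication_algebra A}
     bounded_implication_hom"
proof (unfold_locales, goal_cases)
  case (1 A B h)
  then show ?case
    by (simp add: bounded_implication_hom_def)
next
  case (2 A)
  then interpret bounded_implication_algebra A by simp
  show ?case
    by (simp add: bounded_implication_hom_def closed)
next
  case (3 A B C f g)
  then interpret bounded_implication_algebra A by simp
  show ?case
    using 3 by (auto simp: bounded_implication_hom_def compose_def closed PiE_iff Pi_iff)
qed

lemma concrete_homs_bool_alg:
  "concrete_homs {A :: 'a bool_alg. bool_alg A} bool_alg_hom"
proof (unfold_locales, goal_cases)
  case (1 A B h)
  then show ?case
    by (simp add: bool_alg_hom_def)
next
  case (2 A)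
  then interpret bool_alg A by simp
  show ?case
    by (simp add: bool_alg_hom_def closed)
next
  case (3 A B C f g)
  then interpret bool_alg A by simp
  show ?case
    using 3 by (auto simp: bool_alg_hom_def compose_def closed PiE_iff Pi_iff)
qed

text \<open>Each signature is definable by terms in the other: implication from \<open>compl\<close>
  and \<open>join\<close>, and conversely all Boolean operations from implication and
  \<open>c\<^sub>0\<close>.\<close>

lemma bool_alg_hom_bool_alg_of:
  assumes "bounded_implication_algebra A" and "bounded_implication_algebra B"
  shows "bool_alg_hom (bool_alg_of A) (bool_alg_of B) = bounded_implication_hom A B"
proof -
  interpret A: bounded_implication_algebra A by fact
  interpret B: bounded_implication_algebra B by fact
  show ?thesis
  proof (intro equalityI subsetI)
    fix h assume "h \<in> bool_alg_hom (bool_alg_of A) (bool_alg_of B)"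
    then have h: "h \<in> carrier A \<rightarrow>\<^sub>E carrier B" "h c\<^sub>0\<^bsub>A\<^esub> = c\<^sub>0\<^bsub>B\<^esub>"
      and join: "\<And>x y. \<lbrakk>x \<in> carrier A; y \<in> carrier A\<rbrakk> \<Longrightarrow> h (A.join x y) = B.join (h x) (h y)"
      and compl: "\<And>x. x \<in> carrier A \<Longrightarrow> h (A.compl x) = B.compl (h x)"
      by (auto simp: bool_alg_hom_def bool_alg_of_def PiE_iff)
    have "h (x \<cdot>\<^bsub>A\<^esub> y) = h x \<cdot>\<^bsub>B\<^esub> h y" if xy: "x \<in> carrier A" "y \<in> carrier A" for x y
    proof -
      have "h x \<in> carrier B" "h y \<in> carrier B"
        using h(1) xy by auto
      then show ?thesis
        using xy by (simp flip: A.compl_join_imp B.compl_join_imp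
            add: join compl A.compl_in_carrier)
    qed
    with h show "h \<in> bounded_implication_hom A B"
      by (simp add: bounded_implication_hom_def)
  next
    fix h assume "h \<in> bounded_implication_hom A B"
    then have h: "h \<in> carrier A \<rightarrow>\<^sub>E carrier B" "h c\<^sub>0\<^bsub>A\<^esub> = c\<^sub>0\<^bsub>B\<^esub>"
      and imp: "\<And>x y. \<lbrakk>x \<in> carrier A; y \<in> carrier A\<rbrakk> \<Longrightarrow> h (x \<cdot>\<^bsub>A\<^esub> y) = h x \<cdot>\<^bsub>B\<^esub> h y"
      by (auto simp: bounded_implication_hom_def)
    have mem: "h x \<in> carrier B" if "x \<in> carrier A" for x
      using h(1) that by auto
    have join: "h (A.join x y) = B.join (h x) (h y)" if "x \<in> carrier A" "y \<in> carrier A" for x y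
      using that by (simp add: A.join_def B.join_def imp A.closed)
    have compl: "h (A.compl x) = B.compl (h x)" if "x \<in> carrier A" for x
      using that by (simp add: A.compl_def B.compl_def imp h A.closed)
    have meet: "h (A.meet x y) = B.meet (h x) (h y)" if "x \<in> carrier A" "y \<in> carrier A" for x y
      using that by (simp add: A.meet_def B.meet_def join compl A.closed A.compl_in_carrier)
    \<comment> \<open>The top element is the complement of \<open>c\<^sub>0\<close>, and
      \<open>h\<close> preserves both.\<close>
    have "h c\<^sub>1\<^bsub>A\<^esub> = c\<^sub>1\<^bsub>B\<^esub>"
      using compl[OF A.const0_closed] h(2) by (simp add: A.compl_const0 B.compl_const0)
    then show "h \<in> bool_alg_hom (bool_alg_of A) (bool_alg_of B)"
      using h mem by (simp add: bool_alg_hom_def bool_alg_of_def join compl meet)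
  qed
qed

theorem theorem2p15:
  shows "isomorphic_categories
           (IA01 :: ('a bounded_implication_algebra, 'a bounded_implication_arrow) category)
           (BA :: ('a bool_alg, 'a bool_alg_arrow) category)"
  unfolding IA01_def BA_def
  by (rule isomorphic_concrete_categories
      [OF concrete_homs_bounded_implication concrete_homs_bool_alg,
        where \<Phi> = bool_alg_of and \<Psi> = implication_algebra_of])
    (auto simp: bounded_implication_algebra.bool_alg_bool_alg_of
      bool_alg.bounded_implication_algebra_of implication_algebra_of_bool_alg_of
      bool_alg_of_implication_algebra_of bool_alg_hom_bool_alg_of)

end
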